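(* Let $\mathscr{H}$ be a complex Hilbert space and let $A\in\mathbb{B}(\mathscr{H})$. Then $$w^2(A)\leq\frac{1}{2}\left[\|A\|^2\left(\min_{t\in[0,1]}\|tA^*A+(1-t)AA^*\|\right)+w^2(A^2)+w(A^2)\,\|A^*A+AA^*\|\right]^{\frac{1}{2}}.$$
   Context: $\mathbb{B}(\mathscr{H})$ is the algebra of all bounded linear operators on the complex Hilbert space $\mathscr{H}$, and $\|\cdot\|$ is the operator norm. For $T\in\mathbb{B}(\mathscr{H})$, the numerical radius is $w(T)=\sup\{|\langle Tx,x\rangle|: x\in\mathscr{H},\ \|x\|=1\}$, and $w^2(T)$ means $(w(T))^2$. *)

theory Defs
  imports "HOL-Analysis.Analysis"
begin

text \<open>
  A complex inner product space extends its underlying real inner product space, whose inner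
  product is the real part of the complex one. Positive definiteness and the relation to the norm
  follow, see \<open>cinner_self\<close> below. The inner product is linear in the first argument.
\<close>

class complex_inner = real_inner +
  fixes scaleC :: "complex \<Rightarrow> 'a \<Rightarrow> 'a"  (infixr "*\<^sub>C" 75)
    and cinner :: "'a \<Rightarrow> 'a \<Rightarrow> complex"
  assumes scaleC_add_right: "c *\<^sub>C (x + y) = c *\<^sub>C x + c *\<^sub>C y"
    and scaleC_add_left: "(c + d) *\<^sub>C x = c *\<^sub>C x + d *\<^sub>C x"
    and scaleC_scaleC: "c *\<^sub>C d *\<^sub>C x = (c * d) *\<^sub>C x"
    and scaleR_scaleC: "r *\<^sub>R x = complex_of_real r *\<^sub>C x"
    and cinner_commute: "cinner x y = cnj (cinner y x)"
    and cinner_add_left: "cinner (x + y) z = cinner x z + cinner y z"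
    and cinner_scaleC_left: "cinner (c *\<^sub>C x) y = c * cinner x y"
    and inner_eq_Re_cinner: "inner x y = Re (cinner x y)"

lemma cinner_self: "cinner x x = complex_of_real ((norm x)\<^sup>2)"
  for x :: "'a::complex_inner"
proof (rule complex_eqI)
  show "Re (cinner x x) = Re (complex_of_real ((norm x)\<^sup>2))"
    by (simp add: inner_eq_Re_cinner[symmetric] dot_square_norm)
  have "Im (cinner x x) = - Im (cinner x x)"
    by (metis cinner_commute cnj.sel(2))
  then show "Im (cinner x x) = Im (complex_of_real ((norm x)\<^sup>2))"
    by simp
qed

class complex_hilbert_space = complex_inner + complete_space

definition bounded_clinear :: "('a::complex_inner \<Rightarrow> 'b::complex_inner) \<Rightarrow> bool" where
  "bounded_clinear T \<longleftrightarrow> bounded_linear T \<and> (\<forall>c x. T (c *\<^sub>C x) = c *\<^sub>C T x)"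

text \<open>
  At most one map satisfies the defining identity; for a bounded operator on a Hilbert space one
  exists by the Riesz representation theorem.
\<close>

definition cadjoint :: "('a::complex_inner \<Rightarrow> 'b::complex_inner) \<Rightarrow> 'b \<Rightarrow> 'a" where
  "cadjoint T = (THE S. \<forall>x y. cinner (T x) y = cinner x (S y))"

text \<open>
  The supremum is taken in the nonnegative reals: inserting \<open>0\<close> matters only for the zero space,
  which has no unit vectors and where \<open>Sup {}\<close> in type \<open>real\<close> is unspecified.
\<close>

definition numerical_radius :: "('a::complex_inner \<Rightarrow> 'a) \<Rightarrow> real" where
  "numerical_radius T = Sup (insert 0 {cmod (cinner (T x) x) |x. norm x = 1})"

end

theory Submission imports Defs begin

text \<open>
  Fix a unit vector \<open>x\<close>. Buzano's inequality, applied to \<open>A x\<close> and \<open>A\<^sup>* x\<close>, gives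
  \<open>|\<langle>A x, x\<rangle>|\<^sup>2 \<le> (\<parallel>A x\<parallel> \<parallel>A\<^sup>* x\<parallel> + |\<langle>A\<^sup>2 x, x\<rangle>|) / 2\<close>. Square this and put \<open>a = \<parallel>A x\<parallel>\<^sup>2\<close>,
  \<open>b = \<parallel>A\<^sup>* x\<parallel>\<^sup>2\<close>. The cross term is controlled by
  \<open>2 \<parallel>A x\<parallel> \<parallel>A\<^sup>* x\<parallel> \<le> a + b = \<langle>(A\<^sup>*A + AA\<^sup>*) x, x\<rangle>\<close>. The remaining product is
  \<open>a b = max a b \<cdot> min a b\<close>, where the maximum is at most \<open>\<parallel>A\<parallel>\<^sup>2\<close> and the minimum is at most
  every convex combination \<open>t a + (1 - t) b = \<langle>(t A\<^sup>*A + (1 - t) AA\<^sup>*) x, x\<rangle>\<close>. So the bound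
  holds for every \<open>t \<in> [0,1]\<close>; taking the supremum over \<open>x\<close> gives the inequality.

  The minimum over \<open>t\<close> is attained because the norm of an affine pencil of bounded operators is
  a continuous function of the parameter. The adjoint is obtained from the Riesz representation
  theorem, which is proved by minimizing the functional \<open>\<parallel>v\<parallel>\<^sup>2 - 2 f v\<close>: the parallelogram law
  makes minimizing sequences Cauchy.
\<close>

section \<open>Complex inner products\<close>

lemma cinner_add_right: "cinner x (y + z) = cinner x y + cinner x z"
  for x :: "'a::complex_inner"
  by (metis cinner_commute cinner_add_left complex_cnj_add)

lemma cinner_scaleC_right: "cinner x (c *\<^sub>C y) = cnj c * cinner x y"
  for x :: "'a::complex_inner"
  by (metis cinner_commute cinner_scaleC_left complex_cnj_mult)

lemma cinner_diff_left: "cinner (x - y) z = cinner x z - cinner y z"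
  for x :: "'a::complex_inner"
  by (metis add_diff_cancel_right' cinner_add_left diff_add_cancel)

lemma norm_scaleC: "norm (c *\<^sub>C x) = cmod c * norm x"
  for x :: "'a::complex_inner"
proof -
  have "complex_of_real ((norm (c *\<^sub>C x))\<^sup>2) = (c * cnj c) * cinner x x"
    unfolding cinner_self[symmetric] by (simp add: cinner_scaleC_left cinner_scaleC_right)
  also have "\<dots> = complex_of_real ((cmod c * norm x)\<^sup>2)"
    by (simp add: cinner_self complex_norm_square[symmetric] power_mult_distrib del: of_real_power)
  finally have "(norm (c *\<^sub>C x))\<^sup>2 = (cmod c * norm x)\<^sup>2"
    by (simp only: of_real_eq_iff)
  then show ?thesis
    by (simp add: power2_eq_iff_nonneg)
qed

text \<open>
  The real Cauchy-Schwarz inequality suffices after a rotation of \<open>x\<close> that makes the complex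
  inner product real and nonnegative.
\<close>

lemma cmod_cinner_le: "cmod (cinner x y) \<le> norm x * norm y"
  for x :: "'a::complex_inner"
proof (cases "cinner x y = 0")
  case False
  define c where "c = cnj (cinner x y) / complex_of_real (cmod (cinner x y))"
  have c: "cmod c = 1"
    using False by (simp add: c_def norm_divide)
  have "c * cinner x y = complex_of_real (cmod (cinner x y))"
    using False
    by (simp add: c_def field_simps complex_norm_square[symmetric] power2_eq_square)
  then have "cmod (cinner x y) = inner (c *\<^sub>C x) y"
    by (simp add: inner_eq_Re_cinner cinner_scaleC_left)
  also have "\<dots> \<le> norm (c *\<^sub>C x) * norm y"
    by (rule norm_cauchy_schwarz)
  finally show ?thesis
    by (simp add: norm_scaleC c)
qed simp

text \<open>
  Real parts determine the inner product because \<open>Im z = Re (- \<i> z)\<close> and \<open>- \<i>\<close> can be moved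
  into the first argument.
\<close>

lemma Im_cinner: "Im (cinner x y) = inner (- \<i> *\<^sub>C x) y"
  for x :: "'a::complex_inner"
  by (simp add: inner_eq_Re_cinner cinner_scaleC_left)

text \<open>
  Buzano's inequality is the Cauchy-Schwarz inequality for \<open>b\<close> and the reflection
  \<open>2 \<langle>a, x\<rangle> x - a\<close> of \<open>a\<close> in the line spanned by \<open>x\<close>, which has the same norm as \<open>a\<close>.
\<close>

lemma Buzano_inequality:
  fixes a b x :: "'a::complex_inner"
  assumes "norm x = 1"
  shows "cmod (cinner a x * cinner x b) \<le> (norm a * norm b + cmod (cinner a b)) / 2"
proof -
  define u where "u = (2 * cinner a x) *\<^sub>C x - a"
  have "inner (cinner a x *\<^sub>C x) a = (cmod (cinner a x))\<^sup>2"
  proof -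
    have "cinner (cinner a x *\<^sub>C x) a = cinner a x * cnj (cinner a x)"
      by (metis cinner_scaleC_left cinner_commute)
    also have "\<dots> = complex_of_real ((cmod (cinner a x))\<^sup>2)"
      by (simp only: complex_norm_square)
    finally show ?thesis
      by (simp only: inner_eq_Re_cinner Re_complex_of_real)
  qed
  moreover have "(2 * cinner a x) *\<^sub>C x = 2 *\<^sub>R (cinner a x *\<^sub>C x)"
    by (simp add: scaleR_scaleC scaleC_scaleC)
  moreover have "norm (cinner a x *\<^sub>C x) = cmod (cinner a x)"
    using assms by (simp add: norm_scaleC)
  ultimately have "(norm u)\<^sup>2 = (norm a)\<^sup>2"
    by (simp add: u_def power2_norm_eq_inner inner_diff_left inner_diff_right inner_commute
        norm_eq_sqrt_inner)
  then have u: "norm u = norm a"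
    by (simp add: power2_eq_iff_nonneg)
  have "2 * (cinner a x * cinner x b) = cinner u b + cinner a b"
    by (simp add: u_def cinner_diff_left cinner_scaleC_left)
  then have "2 * cmod (cinner a x * cinner x b) = cmod (cinner u b + cinner a b)"
    by (metis norm_mult norm_numeral)
  also have "\<dots> \<le> norm a * norm b + cmod (cinner a b)"
    using norm_triangle_ineq[of "cinner u b" "cinner a b"] cmod_cinner_le[of u b] u by simp
  finally show ?thesis
    by simp
qed

section \<open>Riesz representation and the adjoint\<close>

text \<open>
  The representing vector minimizes \<open>J v = \<parallel>v\<parallel>\<^sup>2 - 2 f v\<close>. By the parallelogram law,
  \<open>\<parallel>v - w\<parallel>\<^sup>2 = 2 J v + 2 J w - 4 J ((v + w) / 2)\<close>, so a minimizing sequence is Cauchy;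
  at the minimum the derivative \<open>2 \<langle>z, h\<rangle> - 2 f h\<close> vanishes in every direction \<open>h\<close>.
\<close>

lemma Riesz_representation:
  fixes f :: "'a::{real_inner,complete_space} \<Rightarrow> real"
  assumes "bounded_linear f"
  shows "\<exists>z. \<forall>x. f x = inner x z"
proof -
  interpret f: bounded_linear f by fact
  define J where "J v = (norm v)\<^sup>2 - 2 * f v" for v
  define m where "m = Inf (range J)"
  have "- (onorm f)\<^sup>2 \<le> J v" for v
  proof -
    have "f v \<le> onorm f * norm v"
      using onorm[OF assms, of v] by simp
    moreover have "0 \<le> (norm v - onorm f)\<^sup>2"
      by simp
    ultimately show ?thesis
      unfolding J_def by (simp add: power2_diff algebra_simps)
  qed
  then have bdd: "bdd_below (range J)"
    by (intro bdd_belowI[where m = "- (onorm f)\<^sup>2"]) auto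
  have m_le: "m \<le> J v" for v
    unfolding m_def by (rule cInf_lower[OF _ bdd]) simp
  have "\<exists>v. J v < m + inverse (real (Suc n))" for n
  proof -
    have "m < m + inverse (real (Suc n))"
      by simp
    then have "\<exists>r\<in>range J. r < m + inverse (real (Suc n))"
      using cInf_less_iff[OF _ bdd] unfolding m_def by blast
    then show ?thesis
      by blast
  qed
  then obtain v where v: "\<And>n. J (v n) < m + inverse (real (Suc n))"
    by metis
  have parallelogram:
    "(norm (x - y))\<^sup>2 = 2 * J x + 2 * J y - 4 * J ((1 / 2) *\<^sub>R (x + y))" for x y
    by (simp add: J_def f.add f.scaleR power2_norm_eq_inner inner_add_left inner_add_right
        inner_diff_left inner_diff_right inner_commute algebra_simps)
  have "Cauchy v"
  proof (rule metric_CauchyI)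
    fix e :: real
    assume "0 < e"
    then obtain N where N: "inverse (real (Suc N)) < e\<^sup>2 / 4"
      using reals_Archimedean[of "e\<^sup>2 / 4"] by auto
    have close: "J (v n) < m + e\<^sup>2 / 4" if "N \<le> n" for n
    proof -
      have "inverse (real (Suc n)) \<le> inverse (real (Suc N))"
        using that by (intro le_imp_inverse_le) auto
      then show ?thesis
        using v[of n] N by linarith
    qed
    have "dist (v i) (v j) < e" if "N \<le> i" "N \<le> j" for i j
    proof -
      have "(norm (v i - v j))\<^sup>2 < e\<^sup>2"
        using parallelogram[of "v i" "v j"] close[OF that(1)] close[OF that(2)]
          m_le[of "(1 / 2) *\<^sub>R (v i + v j)"] by linarith
      then show ?thesis
        using \<open>0 < e\<close> by (simp add: dist_norm power_less_imp_less_base)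
    qed
    then show "\<exists>M. \<forall>i\<ge>M. \<forall>j\<ge>M. dist (v i) (v j) < e"
      by blast
  qed
  then obtain z where z: "v \<longlonglongrightarrow> z"
    by (meson Cauchy_convergent convergent_def)
  have "(\<lambda>n. J (v n)) \<longlonglongrightarrow> J z"
    unfolding J_def by (intro tendsto_intros z f.tendsto)
  moreover have "(\<lambda>n. m + inverse (real (Suc n))) \<longlonglongrightarrow> m + 0"
    by (intro tendsto_intros LIMSEQ_inverse_real_of_nat)
  ultimately have J_z: "J z \<le> m"
    using LIMSEQ_le[of "\<lambda>n. J (v n)" "J z" "\<lambda>n. m + inverse (real (Suc n))" m] v
    by (auto intro: less_imp_le)
  have "f h = inner h z" for h
  proof -
    define d where "d = inner h z - f h"
    have quadratic: "0 \<le> t\<^sup>2 * (norm h)\<^sup>2 + 2 * t * d" for t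
    proof -
      have "J (z + t *\<^sub>R h) = J z + (t\<^sup>2 * (norm h)\<^sup>2 + 2 * t * d)"
        unfolding J_def d_def power2_norm_eq_inner
        by (simp add: f.add f.scaleR inner_commute algebra_simps power2_eq_square)
      then show ?thesis
        using m_le[of "z + t *\<^sub>R h"] J_z by linarith
    qed
    \<comment> \<open>A step of this length against the slope \<open>d\<close> keeps the quadratic term below half of the
      linear one; the added 1 covers \<open>h = 0\<close>.\<close>
    define s where "s = 1 / (1 + (norm h)\<^sup>2)"
    have pos: "0 < 1 + (norm h)\<^sup>2"
      by (simp add: add_pos_nonneg)
    then have s: "0 < s" "s * (norm h)\<^sup>2 \<le> 1"
      by (simp_all add: s_def divide_simps)
    have "0 \<le> (- s * d)\<^sup>2 * (norm h)\<^sup>2 + 2 * (- s * d) * d"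
      by (rule quadratic)
    also have "\<dots> = s * d\<^sup>2 * (s * (norm h)\<^sup>2 - 2)"
      by (simp add: power2_eq_square algebra_simps)
    finally have "0 \<le> s * d\<^sup>2 * (s * (norm h)\<^sup>2 - 2)" .
    then have "s * d\<^sup>2 \<le> 0"
      using s(2) by (simp add: zero_le_mult_iff)
    then have "d = 0"
      using s(1) by (simp add: mult_le_0_iff)
    then show ?thesis
      by (simp add: d_def)
  qed
  then show ?thesis
    by blast
qed

text \<open>
  Representing the real functionals \<open>x \<mapsto> Re \<langle>T x, y\<rangle>\<close> already gives the complex identity,
  since \<open>T\<close> commutes with multiplication by \<open>\<i>\<close>.
\<close>

lemma cinner_cadjoint:
  fixes T :: "'a::complex_hilbert_space \<Rightarrow> 'b::complex_inner"
  assumes "bounded_clinear T"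
  shows "cinner (T x) y = cinner x (cadjoint T y)"
proof -
  have T: "bounded_linear T" and T_scaleC: "T (c *\<^sub>C x) = c *\<^sub>C T x" for c x
    using assms by (auto simp: bounded_clinear_def)
  have "\<exists>z. \<forall>x. inner (T x) y = inner x z" for y
    by (rule Riesz_representation)
      (rule bounded_linear_compose[OF bounded_linear_inner_left T])
  then obtain S where S: "\<And>x y. inner (T x) y = inner x (S y)"
    by metis
  have S_adjoint: "\<forall>x y. cinner (T x) y = cinner x (S y)"
  proof (intro allI complex_eqI)
    fix x y
    show "Re (cinner (T x) y) = Re (cinner x (S y))"
      using S by (simp add: inner_eq_Re_cinner)
    show "Im (cinner (T x) y) = Im (cinner x (S y))"
      by (simp only: Im_cinner S[symmetric] T_scaleC)
  qed
  have unique: "S' = S" if S': "\<forall>x y. cinner (T x) y = cinner x (S' y)" for S'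
  proof
    fix y
    have "cinner x (S' y) = cinner x (S y)" for x
      using S' S_adjoint by metis
    then have "inner x (S' y) = inner x (S y)" for x
      by (simp only: inner_eq_Re_cinner)
    then show "S' y = S y"
      by (metis vector_eq_ldot)
  qed
  have "cadjoint T = S"
    unfolding cadjoint_def by (rule the_equality, fact S_adjoint, rule unique)
  then show ?thesis
    using S_adjoint by simp
qed

lemma inner_cadjoint:
  fixes T :: "'a::complex_hilbert_space \<Rightarrow> 'b::complex_inner"
  assumes "bounded_clinear T"
  shows "inner (T x) y = inner x (cadjoint T y)"
  by (simp add: inner_eq_Re_cinner cinner_cadjoint[OF assms])

lemma norm_cadjoint_le:
  fixes T :: "'a::complex_hilbert_space \<Rightarrow> 'b::complex_inner"
  assumes "bounded_clinear T"
  shows "norm (cadjoint T y) \<le> onorm T * norm y"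
proof (cases "cadjoint T y = 0")
  case True
  then show ?thesis
    using assms by (simp add: bounded_clinear_def onorm_pos_le)
next
  case False
  let ?s = "cadjoint T y"
  have "norm ?s * norm ?s = inner (T ?s) y"
    by (simp add: inner_cadjoint[OF assms] norm_eq_sqrt_inner)
  also have "\<dots> \<le> norm (T ?s) * norm y"
    by (rule norm_cauchy_schwarz)
  also have "\<dots> \<le> onorm T * norm ?s * norm y"
    using assms by (intro mult_right_mono onorm) (auto simp: bounded_clinear_def)
  finally have "norm ?s * norm ?s \<le> norm ?s * (onorm T * norm y)"
    by (simp add: mult_ac)
  then show ?thesis
    using False by (simp add: mult_le_cancel_left)
qed

lemma bounded_linear_cadjoint:
  fixes T :: "'a::complex_hilbert_space \<Rightarrow> 'b::complex_inner"
  assumes "bounded_clinear T"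
  shows "bounded_linear (cadjoint T)"
proof (rule bounded_linear_intro)
  have "inner x (cadjoint T (y + z)) = inner x (cadjoint T y + cadjoint T z)" for x y z
    by (simp add: inner_cadjoint[OF assms, symmetric] inner_add_right)
  then show "cadjoint T (y + z) = cadjoint T y + cadjoint T z" for y z
    by (metis vector_eq_ldot)
  have "inner x (cadjoint T (r *\<^sub>R y)) = inner x (r *\<^sub>R cadjoint T y)" for x y r
    by (simp add: inner_cadjoint[OF assms, symmetric])
  then show "cadjoint T (r *\<^sub>R y) = r *\<^sub>R cadjoint T y" for y r
    by (metis vector_eq_ldot)
  show "norm (cadjoint T y) \<le> norm y * onorm T" for y
    using norm_cadjoint_le[OF assms, of y] by (simp add: mult.commute)
qed

section \<open>Operator norm and numerical radius\<close>

lemma inner_le_onorm: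
  fixes T :: "'a::real_inner \<Rightarrow> 'a"
  assumes "bounded_linear T" and "norm x = 1"
  shows "inner (T x) x \<le> onorm T"
  using norm_cauchy_schwarz[of "T x" x] onorm[OF assms(1), of x] assms(2) by simp

lemma bdd_above_numerical_values:
  fixes T :: "'a::complex_inner \<Rightarrow> 'a"
  assumes "bounded_linear T"
  shows "bdd_above (insert 0 {cmod (cinner (T x) x) |x. norm x = 1})"
proof -
  have "cmod (cinner (T y) y) \<le> onorm T" if "norm y = 1" for y
    using cmod_cinner_le[of "T y" y] onorm[OF assms, of y] that by simp
  then show ?thesis
    using onorm_pos_le[OF assms] by (auto intro!: bdd_aboveI[where M = "onorm T"])
qed

lemma numerical_radius_upper:
  fixes T :: "'a::complex_inner \<Rightarrow> 'a"
  assumes "bounded_linear T" and "norm x = 1"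
  shows "cmod (cinner (T x) x) \<le> numerical_radius T"
  unfolding numerical_radius_def
  by (rule cSup_upper[OF _ bdd_above_numerical_values[OF assms(1)]]) (use assms(2) in auto)

lemma numerical_radius_least:
  fixes T :: "'a::complex_inner \<Rightarrow> 'a"
  assumes "0 \<le> B" and "\<And>x. norm x = 1 \<Longrightarrow> cmod (cinner (T x) x) \<le> B"
  shows "numerical_radius T \<le> B"
  unfolding numerical_radius_def using assms by (auto intro!: cSup_least)

lemma numerical_radius_nonneg:
  fixes T :: "'a::complex_inner \<Rightarrow> 'a"
  assumes "bounded_linear T"
  shows "0 \<le> numerical_radius T"
  unfolding numerical_radius_def
  by (rule cSup_upper[OF _ bdd_above_numerical_values[OF assms]]) simp

text \<open>
  Moving the parameter from \<open>s\<close> to \<open>t\<close> changes the operator by \<open>(t - s) (F - G)\<close>, so the norm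
  is Lipschitz in the parameter.
\<close>

lemma continuous_on_onorm_segment:
  fixes F G :: "'a::real_normed_vector \<Rightarrow> 'b::real_normed_vector"
  assumes F: "bounded_linear F" and G: "bounded_linear G"
  shows "continuous_on S (\<lambda>t. onorm (\<lambda>x. t *\<^sub>R F x + (1 - t) *\<^sub>R G x))"
proof -
  define N where "N t = onorm (\<lambda>x. t *\<^sub>R F x + (1 - t) *\<^sub>R G x)" for t
  define D where "D = onorm (\<lambda>x. F x - G x)"
  have lin: "bounded_linear (\<lambda>x. t *\<^sub>R F x + (1 - t) *\<^sub>R G x)" for t
    by (intro bounded_linear_add bounded_linear_scaleR_right F G
        bounded_linear_compose[OF bounded_linear_scaleR_right])
  have diff: "bounded_linear (\<lambda>x. F x - G x)"
    by (intro bounded_linear_sub F G)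
  have step: "N t \<le> N s + \<bar>t - s\<bar> * D" for s t
  proof -
    have "(\<lambda>x. t *\<^sub>R F x + (1 - t) *\<^sub>R G x) =
        (\<lambda>x. (s *\<^sub>R F x + (1 - s) *\<^sub>R G x) + (t - s) *\<^sub>R (F x - G x))"
      by (auto simp: algebra_simps)
    then have "N t \<le> N s + onorm (\<lambda>x. (t - s) *\<^sub>R (F x - G x))"
      unfolding N_def
      using onorm_triangle[OF lin[of s]
          bounded_linear_compose[OF bounded_linear_scaleR_right[of "t - s"] diff]] by simp
    then show ?thesis
      by (simp add: onorm_scaleR[OF diff] D_def)
  qed
  have "D-lipschitz_on S N"
  proof (rule lipschitz_onI)
    show "dist (N t) (N s) \<le> D * dist t s" for t s
      using step[of t s] step[of s t]
      by (simp add: dist_real_def abs_minus_commute mult.commute abs_le_iff)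
    show "0 \<le> D"
      unfolding D_def by (rule onorm_pos_le[OF diff])
  qed
  then show ?thesis
    using lipschitz_on_continuous_on unfolding N_def by blast
qed

section \<open>The numerical radius bound\<close>

text \<open>
  The product is \<open>max a b \<cdot> min a b\<close>; the maximum is at most \<open>M\<close> and the minimum is at most
  any weighted mean of \<open>a\<close> and \<open>b\<close>.
\<close>

lemma mult_le_bound_times_convex_combination:
  fixes a b t M :: real
  assumes "0 \<le> a" "a \<le> M" "0 \<le> b" "b \<le> M" "0 \<le> t" "t \<le> 1"
  shows "a * b \<le> M * (t * a + (1 - t) * b)"
proof -
  have "min a b = t * min a b + (1 - t) * min a b"
    by (simp add: algebra_simps)
  also have "\<dots> \<le> t * a + (1 - t) * b"
    using assms by (intro add_mono mult_left_mono) auto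
  finally have "min a b \<le> t * a + (1 - t) * b" .
  then have "max a b * min a b \<le> M * (t * a + (1 - t) * b)"
    using assms by (intro mult_mono) auto
  then show ?thesis
    by (simp add: max_def min_def mult.commute split: if_splits)
qed

text \<open>
  With \<open>p = \<parallel>A x\<parallel>\<close>, \<open>q = \<parallel>A\<^sup>* x\<parallel>\<close> and \<open>r = |\<langle>A\<^sup>2 x, x\<rangle>|\<close>, Buzano's inequality reads
  \<open>|\<langle>A x, x\<rangle>|\<^sup>2 \<le> (p q + r) / 2\<close>, and the radicand dominates \<open>(p q + r)\<^sup>2\<close> term by term. No
  special choice of \<open>t\<close> enters, so the minimizer can be inserted afterwards.
\<close>

lemma numerical_radius_sq_le:
  fixes A :: "'a::complex_hilbert_space \<Rightarrow> 'a"
  assumes A: "bounded_clinear A" and t: "0 \<le> t" "t \<le> 1"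
  shows "(numerical_radius A)\<^sup>2 \<le>
    1 / 2 * sqrt ((onorm A)\<^sup>2 * onorm (\<lambda>x. t *\<^sub>R cadjoint A (A x) + (1 - t) *\<^sub>R A (cadjoint A x))
      + (numerical_radius (A \<circ> A))\<^sup>2
      + numerical_radius (A \<circ> A) * onorm (\<lambda>x. cadjoint A (A x) + A (cadjoint A x)))"
    (is "_ \<le> 1 / 2 * sqrt (_ * onorm ?P + ?w\<^sup>2 + ?w * onorm ?Q)")
proof -
  have lin: "bounded_linear A"
    using A by (simp add: bounded_clinear_def)
  note adj = bounded_linear_cadjoint[OF A]
  note comps = bounded_linear_compose[OF adj lin] bounded_linear_compose[OF lin adj]
  have P: "bounded_linear ?P"
    by (intro bounded_linear_add comps bounded_linear_compose[OF bounded_linear_scaleR_right])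
  have Q: "bounded_linear ?Q"
    by (intro bounded_linear_add comps)
  have AA: "bounded_linear (A \<circ> A)"
    using bounded_linear_compose[OF lin lin] by (simp add: comp_def)
  define E where "E = (onorm A)\<^sup>2 * onorm ?P + ?w\<^sup>2 + ?w * onorm ?Q"
  have w: "0 \<le> ?w"
    by (rule numerical_radius_nonneg[OF AA])
  have "0 \<le> E"
    unfolding E_def
    by (intro add_nonneg_nonneg mult_nonneg_nonneg w onorm_pos_le P Q) auto
  have pointwise: "(cmod (cinner (A x) x))\<^sup>2 \<le> 1 / 2 * sqrt E" if x: "norm x = 1" for x
  proof -
    define p where "p = norm (A x)"
    define q where "q = norm (cadjoint A x)"
    define r where "r = cmod (cinner ((A \<circ> A) x) x)"
    have r: "0 \<le> r" "r \<le> ?w"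
      unfolding r_def by (simp, rule numerical_radius_upper[OF AA x])
    have pq: "0 \<le> p" "p \<le> onorm A" "0 \<le> q" "q \<le> onorm A"
      using onorm[OF lin, of x] norm_cadjoint_le[OF A, of x] x by (simp_all add: p_def q_def)
    have p_sq: "inner (cadjoint A (A x)) x = p\<^sup>2"
      using inner_cadjoint[OF A, of x "A x"]
      by (simp add: p_def power2_norm_eq_inner inner_commute)
    have q_sq: "inner (A (cadjoint A x)) x = q\<^sup>2"
      by (simp add: inner_cadjoint[OF A] q_def power2_norm_eq_inner)
    have "t * p\<^sup>2 + (1 - t) * q\<^sup>2 \<le> onorm ?P"
      using inner_le_onorm[OF P x] by (simp add: inner_add_left p_sq q_sq)
    then have "(onorm A)\<^sup>2 * (t * p\<^sup>2 + (1 - t) * q\<^sup>2) \<le> (onorm A)\<^sup>2 * onorm ?P"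
      by (rule mult_left_mono) simp
    moreover have "p\<^sup>2 * q\<^sup>2 \<le> (onorm A)\<^sup>2 * (t * p\<^sup>2 + (1 - t) * q\<^sup>2)"
      using pq t by (intro mult_le_bound_times_convex_combination power_mono) simp_all
    ultimately have "p\<^sup>2 * q\<^sup>2 \<le> (onorm A)\<^sup>2 * onorm ?P"
      by linarith
    moreover have "r\<^sup>2 \<le> ?w\<^sup>2"
      using r by (intro power_mono) auto
    moreover have "2 * (p * q) * r \<le> ?w * onorm ?Q"
    proof -
      have "2 * (p * q) \<le> p\<^sup>2 + q\<^sup>2"
        using sum_squares_bound[of p q] by simp
      also have "\<dots> \<le> onorm ?Q"
        using inner_le_onorm[OF Q x] by (simp add: inner_add_left p_sq q_sq)
      finally have "2 * (p * q) * r \<le> onorm ?Q * ?w"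
        using r by (intro mult_mono onorm_pos_le Q)
      then show ?thesis
        by (simp add: mult.commute)
    qed
    ultimately have "(p * q + r)\<^sup>2 \<le> E"
      by (simp add: E_def power2_sum power_mult_distrib)
    then have "p * q + r \<le> sqrt E"
      by (rule real_le_rsqrt)
    moreover have "(cmod (cinner (A x) x))\<^sup>2 \<le> (p * q + r) / 2"
      using Buzano_inequality[OF x, of "A x" "cadjoint A x"]
      by (simp add: cinner_cadjoint[OF A, symmetric] norm_mult power2_eq_square p_def q_def r_def)
    ultimately show ?thesis
      by simp
  qed
  have "numerical_radius A \<le> sqrt (1 / 2 * sqrt E)"
    using pointwise \<open>0 \<le> E\<close> by (intro numerical_radius_least real_le_rsqrt) auto
  then have "(numerical_radius A)\<^sup>2 \<le> (sqrt (1 / 2 * sqrt E))\<^sup>2"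
    by (intro power_mono numerical_radius_nonneg lin)
  then show ?thesis
    using \<open>0 \<le> E\<close> by (simp add: E_def)
qed

theorem theorem2p16:
  fixes A :: "'a::complex_hilbert_space \<Rightarrow> 'a"
  assumes "bounded_clinear A"
  shows "let N = (\<lambda>t::real. onorm (\<lambda>x. t *\<^sub>R cadjoint A (A x) + (1 - t) *\<^sub>R A (cadjoint A x)))
    in \<exists>t\<^sub>0. is_arg_min N (\<lambda>t. t \<in> {0..1}) t\<^sub>0 \<and>
      (numerical_radius A)\<^sup>2 \<le>
        1 / 2 * sqrt ((onorm A)\<^sup>2 * N t\<^sub>0
          + (numerical_radius (A \<circ> A))\<^sup>2
          + numerical_radius (A \<circ> A) * onorm (\<lambda>x. cadjoint A (A x) + A (cadjoint A x)))"
proof -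
  define N where
    "N t = onorm (\<lambda>x. t *\<^sub>R cadjoint A (A x) + (1 - t) *\<^sub>R A (cadjoint A x))" for t :: real
  have lin: "bounded_linear A"
    using assms by (simp add: bounded_clinear_def)
  note adj = bounded_linear_cadjoint[OF assms]
  have "continuous_on {0..1} N"
    unfolding N_def
    by (intro continuous_on_onorm_segment bounded_linear_compose[OF adj lin]
        bounded_linear_compose[OF lin adj])
  then obtain t\<^sub>0 where t\<^sub>0: "t\<^sub>0 \<in> {0..1}" "\<forall>t\<in>{0..1}. N t\<^sub>0 \<le> N t"
    using continuous_attains_inf[of "{0..1::real}" N] by auto
  then have "is_arg_min N (\<lambda>t. t \<in> {0..1}) t\<^sub>0"
    by (auto simp: is_arg_min_def not_less)
  then show ?thesis
    using numerical_radius_sq_le[OF assms, of t\<^sub>0] t\<^sub>0(1) unfolding Let_def N_def by auto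
qed

end
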